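(* Let $L_h$ be the fine-grid operator given by the cell-centered finite volume discretization (with harmonic averages of the coefficient at interior faces) of $-\nabla\cdot(k(\mathbf{x},\omega)\nabla u(\mathbf{x},\omega))=f(\mathbf{x})$, for a fixed realization $\omega$, on the uniform grid of mesh size $h=\ell/M$ of the square $D=(0,\ell)^2$, with $M$ even. Let $P_{2h}^h$ be the piecewise constant prolongation operator and $R_h^{2h}$ its (scaled) adjoint. Then the Galerkin coarse grid operator $\frac12 R_h^{2h}L_hP_{2h}^h$ is equal to the operator obtained by direct discretization on the coarse grid of mesh size $2h$ in which the diffusion coefficient at each coarse face is the arithmetic average of the diffusion coefficients at the two fine faces composing it.
   Context: Let $\ell>0$, $D=(0,\ell)^2$, $M$ an even positive integer, and $h=\ell/M$. The fine grid divides $D$ into $M\times M$ square cells of side $h$, indexed by $(i_1,i_2)$, $1\le i_1,i_2\le M$, where cell $(i_1,i_2)$ has center $((i_1-\frac12)h,(i_2-\frac12)h)$. A grid function assigns one real value $u_{i_1,i_2}$ to each cell. For the fixed realization $\omega$, the coefficient $k$ is positive and constant on each fine cell, with value $k_{i_1,i_2}>0$ on cell $(i_1,i_2)$. The coarse grid consists of $(M/2)\times(M/2)$ cells of side $2h$; the coarse cell $(i_1,i_2)$, $1\le i_1,i_2\le M/2$, is the union of the four fine cells $(2i_1-1,2i_2-1)$, $(2i_1,2i_2-1)$, $(2i_1-1,2i_2)$, $(2i_1,2i_2)$. Direct discretization with given face coefficients: given a uniform grid of mesh size $H$ and a number $\kappa_F$ attached to each cell face $F$, the associated operator is the five-point operator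 $$(Lu)_{i_1,i_2}=c_{i_1,i_2}u_{i_1,i_2}+w_{i_1,i_2}u_{i_1-1,i_2}+e_{i_1,i_2}u_{i_1+1,i_2}+s_{i_1,i_2}u_{i_1,i_2-1}+n_{i_1,i_2}u_{i_1,i_2+1},$$ where, for a cell none of whose faces lies on $\partial D$, the entries $w,e,s,n$ equal $-\kappa_F/H^2$ with $F$ respectively the west, east, south, north face of the cell, and $c=-(w+e+s+n)$. For a cell having faces on $\partial D$, there is no off-diagonal term for a boundary face; a boundary face $F$ with a Dirichlet condition contributes $2\kappa_F/H^2$ to $c$, a boundary face with a Neumann condition contributes $0$ to $c$, and each interior face $F$ contributes $\kappa_F/H^2$ to $c$ and $-\kappa_F/H^2$ to the corresponding off-diagonal entry (boundary data enter only the right-hand side). Each of the four sides of the square carries either a Dirichlet or a Neumann condition. The fine operator $L_h$ is the direct discretization with $H=h$ in which the coefficient of an interior face between two adjacent fine cells with values $k,k'$ is the harmonic mean $\frac{2kk'}{k+k'}$, and the coefficient of a boundary face is the value of $k$ in the adjacent cell. Thus, for instance, for a cell with no face on the boundary, $w^h_{i_1,i_2}=-\frac{2}{h^2}\frac{k_{i_1,i_2}k_{i_1-1,i_2}}{k_{i_1,i_2}+k_{i_1-1,i_2}}$. The piecewise constant prolongation $P_{2h}^h$ maps a coarse grid function $v$ to the fine grid function whose value on each fine cell is the value of $v$ on the coarse cell containing it. The restriction $R_h^{2h}$ is its scaled adjoint: $(R_h^{2h}u)_{i_1,i_2}=\frac14\left(u_{2i_1,2i_2}+u_{2i_1-1,2i_2}+u_{2i_1,2i_2-1}+u_{2i_1-1,2i_2-1}\right)$.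 Each face of a coarse cell is the union of two fine faces. The coarse direct discretization in question is the one with $H=2h$ and with $\kappa_F$, for each coarse face $F$, equal to the arithmetic mean of the coefficients of the two fine faces composing $F$. *)

theory Defs
  imports Complex_Main
begin

text \<open>A grid of N by N cells has cells (i, j) with 1 \<le> i, j \<le> N. A grid function is a
  function of the two cell indices; only its values on these cells are meaningful.\<close>

type_synonym grid_fun = "nat \<Rightarrow> nat \<Rightarrow> real"

datatype side = West | East | South | North

datatype bc = Dirichlet | Neumann

text \<open>\<open>Vert i j\<close> is the face between the cells (i, j) and (i + 1, j), where 0 \<le> i \<le> N;
  \<open>Horiz i j\<close> is the face between the cells (i, j) and (i, j + 1), where 0 \<le> j \<le> N.
  Index values 0 and N in the normal direction give the faces on the boundary of the square.\<close>

datatype face = Vert nat nat | Horiz nat nat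

fun cell_face :: "side \<Rightarrow> nat \<Rightarrow> nat \<Rightarrow> face" where
  "cell_face West i j = Vert (i - 1) j"
| "cell_face East i j = Vert i j"
| "cell_face South i j = Horiz i (j - 1)"
| "cell_face North i j = Horiz i j"

fun boundary_face :: "nat \<Rightarrow> face \<Rightarrow> bool" where
  "boundary_face N (Vert i j) \<longleftrightarrow> i = 0 \<or> i = N"
| "boundary_face N (Horiz i j) \<longleftrightarrow> j = 0 \<or> j = N"

definition off_diag :: "nat \<Rightarrow> real \<Rightarrow> (face \<Rightarrow> real) \<Rightarrow> side \<Rightarrow> nat \<Rightarrow> nat \<Rightarrow> real" where
  "off_diag N H \<kappa> s i j =
     (let F = cell_face s i j in if boundary_face N F then 0 else - \<kappa> F / H^2)"

text \<open>If the face of a cell on its side s lies on the boundary, it lies on side s of the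
  square, so the condition that applies to it is \<open>B s\<close>.\<close>

definition diag_contrib ::
  "nat \<Rightarrow> real \<Rightarrow> (side \<Rightarrow> bc) \<Rightarrow> (face \<Rightarrow> real) \<Rightarrow> side \<Rightarrow> nat \<Rightarrow> nat \<Rightarrow> real" where
  "diag_contrib N H B \<kappa> s i j =
     (let F = cell_face s i j in
      if boundary_face N F
      then (case B s of Dirichlet \<Rightarrow> 2 * \<kappa> F / H^2 | Neumann \<Rightarrow> 0)
      else \<kappa> F / H^2)"

definition diag ::
  "nat \<Rightarrow> real \<Rightarrow> (side \<Rightarrow> bc) \<Rightarrow> (face \<Rightarrow> real) \<Rightarrow> nat \<Rightarrow> nat \<Rightarrow> real" where
  "diag N H B \<kappa> i j =
     diag_contrib N H B \<kappa> West i j + diag_contrib N H B \<kappa> East i j +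
     diag_contrib N H B \<kappa> South i j + diag_contrib N H B \<kappa> North i j"

text \<open>Neighbour values outside the grid are multiplied by a zero off-diagonal entry.\<close>

definition direct_discretization ::
  "nat \<Rightarrow> real \<Rightarrow> (side \<Rightarrow> bc) \<Rightarrow> (face \<Rightarrow> real) \<Rightarrow> grid_fun \<Rightarrow> grid_fun" where
  "direct_discretization N H B \<kappa> u = (\<lambda>i j.
     diag N H B \<kappa> i j * u i j
     + off_diag N H \<kappa> West i j * u (i - 1) j
     + off_diag N H \<kappa> East i j * u (i + 1) j
     + off_diag N H \<kappa> South i j * u i (j - 1)
     + off_diag N H \<kappa> North i j * u i (j + 1))"

definition harmonic_mean :: "real \<Rightarrow> real \<Rightarrow> real" where
  "harmonic_mean a b = 2 * a * b / (a + b)"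

fun fine_face_coeff :: "nat \<Rightarrow> grid_fun \<Rightarrow> face \<Rightarrow> real" where
  "fine_face_coeff M k (Vert i j) =
     (if i = 0 then k 1 j else if i = M then k M j else harmonic_mean (k i j) (k (i + 1) j))"
| "fine_face_coeff M k (Horiz i j) =
     (if j = 0 then k i 1 else if j = M then k i M else harmonic_mean (k i j) (k i (j + 1)))"

definition fine_operator ::
  "nat \<Rightarrow> real \<Rightarrow> (side \<Rightarrow> bc) \<Rightarrow> grid_fun \<Rightarrow> grid_fun \<Rightarrow> grid_fun" where
  "fine_operator M h B k = direct_discretization M h B (fine_face_coeff M k)"

text \<open>The fine cell (i, j) lies in the coarse cell with indices \<open>\<lceil>i/2\<rceil>\<close> and \<open>\<lceil>j/2\<rceil>\<close>.\<close>

definition prolongation :: "grid_fun \<Rightarrow> grid_fun" where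
  "prolongation v = (\<lambda>i j. v ((i + 1) div 2) ((j + 1) div 2))"

definition restriction :: "grid_fun \<Rightarrow> grid_fun" where
  "restriction u = (\<lambda>i j.
     (u (2 * i) (2 * j) + u (2 * i - 1) (2 * j)
      + u (2 * i) (2 * j - 1) + u (2 * i - 1) (2 * j - 1)) / 4)"

text \<open>The coarse face \<open>Vert i j\<close> lies on the fine grid line with index 2 i and is composed of
  the fine faces in rows 2 j - 1 and 2 j; similarly for horizontal faces.\<close>

fun coarse_face_coeff :: "(face \<Rightarrow> real) \<Rightarrow> face \<Rightarrow> real" where
  "coarse_face_coeff \<kappa> (Vert i j) = (\<kappa> (Vert (2 * i) (2 * j - 1)) + \<kappa> (Vert (2 * i) (2 * j))) / 2"
| "coarse_face_coeff \<kappa> (Horiz i j) = (\<kappa> (Horiz (2 * i - 1) (2 * j)) + \<kappa> (Horiz (2 * i) (2 * j))) / 2"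

definition coarse_operator ::
  "nat \<Rightarrow> real \<Rightarrow> (side \<Rightarrow> bc) \<Rightarrow> grid_fun \<Rightarrow> grid_fun \<Rightarrow> grid_fun" where
  "coarse_operator M h B k =
     direct_discretization (M div 2) (2 * h) B (coarse_face_coeff (fine_face_coeff M k))"

definition galerkin_operator ::
  "nat \<Rightarrow> real \<Rightarrow> (side \<Rightarrow> bc) \<Rightarrow> grid_fun \<Rightarrow> grid_fun \<Rightarrow> grid_fun" where
  "galerkin_operator M h B k v =
     (\<lambda>i j. 1/2 * restriction (fine_operator M h B k (prolongation v)) i j)"

end

theory Submission
  imports Defs
begin

text \<open>Group the stencil by faces: each face contributes its diagonal and off-diagonal entry together.
  Since \<open>prolongation v\<close> is constant on each coarse cell, the contributions of the faces interior to
  a coarse cell vanish, and each coarse face receives the contributions of its two fine faces. With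
  the weight 1/8 of the sum, these give the mean face coefficient divided by \<open>(2 h)\<^sup>2\<close>; a
  Dirichlet face scales in the same way.\<close>

fun neighbour :: "side \<Rightarrow> grid_fun \<Rightarrow> grid_fun" where
  "neighbour West u i j = u (i - 1) j"
| "neighbour East u i j = u (i + 1) j"
| "neighbour South u i j = u i (j - 1)"
| "neighbour North u i j = u i (j + 1)"

definition face_term ::
  "nat \<Rightarrow> real \<Rightarrow> (side \<Rightarrow> bc) \<Rightarrow> (face \<Rightarrow> real) \<Rightarrow> side \<Rightarrow> grid_fun \<Rightarrow> grid_fun" where
  "face_term N H B \<kappa> s u i j =
     diag_contrib N H B \<kappa> s i j * u i j + off_diag N H \<kappa> s i j * neighbour s u i j"

lemma direct_discretization_eq_face_terms:
  "direct_discretization N H B \<kappa> u i j =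
     face_term N H B \<kappa> West u i j + face_term N H B \<kappa> East u i j +
     face_term N H B \<kappa> South u i j + face_term N H B \<kappa> North u i j"
  by (simp add: direct_discretization_def diag_def face_term_def algebra_simps)

lemma restriction_add: "restriction (\<lambda>i j. f i j + g i j) i j = restriction f i j + restriction g i j"
  by (simp add: restriction_def add_divide_distrib)

text \<open>The identity already holds side by side. Of the four fine cells, the two away from side
  \<open>s\<close> have their \<open>s\<close>-face inside the coarse cell; the other two have faces
  that compose the coarse face.\<close>

lemma restriction_face_term:
  assumes "1 \<le> i" "1 \<le> j"
  shows "1/2 * restriction (face_term (2 * m) h B \<kappa> s (prolongation v)) i j =
         face_term m (2 * h) B (coarse_face_coeff \<kappa>) s v i j"
proof -
  \<comment> \<open>Successor form removes the truncated subtractions in \<open>i - 1\<close> and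
    \<open>2 * i - 1\<close>.\<close>
  obtain a b where ij: "i = Suc a" "j = Suc b"
    using assms by (metis One_nat_def Suc_le_D)
  \<comment> \<open>Faces inside a coarse cell lie on odd fine grid lines, hence never on the
    boundary line \<open>2 * m\<close>.\<close>
  have odd_ne: "Suc (2 * n) \<noteq> 2 * m" for n
    by presburger
  show ?thesis
    unfolding ij
    by (cases s; cases "B s")
      (simp_all add: restriction_def face_term_def prolongation_def diag_contrib_def off_diag_def
        Let_def odd_ne power2_eq_square divide_simps algebra_simps)
qed

lemma galerkin_direct_discretization:
  assumes "1 \<le> i" "1 \<le> j"
  shows "1/2 * restriction (direct_discretization (2 * m) h B \<kappa> (prolongation v)) i j =
         direct_discretization m (2 * h) B (coarse_face_coeff \<kappa>) v i j"
  \<comment> \<open>The operator stands unapplied under \<open>restriction\<close>, so the splitting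
    is needed as an equation of functions.\<close>
  unfolding direct_discretization_eq_face_terms[abs_def] restriction_add distrib_left
  by (simp only: restriction_face_term[OF assms])

theorem proposition1:
  fixes ell h :: real and M :: nat and B :: "side \<Rightarrow> bc" and k :: grid_fun
  assumes "ell > 0" and "M > 0" and "even M" and "h = ell / real M"
    and "\<And>i j. i \<in> {1..M} \<Longrightarrow> j \<in> {1..M} \<Longrightarrow> k i j > 0"
  shows "\<forall>v :: grid_fun. \<forall>i \<in> {1..M div 2}. \<forall>j \<in> {1..M div 2}.
           galerkin_operator M h B k v i j = coarse_operator M h B k v i j"
proof (intro allI ballI)
  fix v :: grid_fun and i j
  assume "i \<in> {1..M div 2}" "j \<in> {1..M div 2}"
  then have "1 \<le> i" "1 \<le> j"
    by simp_all
  from galerkin_direct_discretization[OF this, of "M div 2" h B "fine_face_coeff M k" v]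
  show "galerkin_operator M h B k v i j = coarse_operator M h B k v i j"
    using \<open>even M\<close> by (simp add: galerkin_operator_def coarse_operator_def fine_operator_def)
qed

end
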